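(* Let $H_1,\dots,H_n,H$ be Hilbert spaces. Then $\|Id:\mathcal L_{HS}(H_1,\dots,H_n;H)\to\Gamma(H_1,\dots,H_n;H)\|\le1$; that is, every Hilbert–Schmidt multilinear operator $T:H_1\times\dots\times H_n\to H$ factors through a Hilbert space and $\Gamma(T)\le\|T\|_{HS}$.
   Context: $\mathcal L_{HS}(H_1,\dots,H_n;H)$ is the space of bounded multilinear operators $T:H_1\times\dots\times H_n\to H$ that are Hilbert–Schmidt, i.e. for which $$\|T\|_{HS}=\Big(\sum_{j_i\in J_i,\ 1\le i\le n}\|T(e^1_{j_1},\dots,e^n_{j_n})\|^2\Big)^{1/2}<\infty,$$ where $(e^i_j)_{j\in J_i}$ is an orthonormal basis of $H_i$ (the value does not depend on the choice of bases). For Banach spaces $X_1,\dots,X_n,Y$, a multilinear operator $T:X_1\times\dots\times X_n\to Y$ factors through a Hilbert space if there exist a Hilbert space $G$, a subset $M\subset G$, a bounded multilinear operator $A:X_1\times\dots\times X_n\to G$ with $A(X_1\times\dots\times X_n)\subset M$, and a Lipschitz function $B:M\to Y$ such that $T=B\circ A$. Then $\Gamma(T)=\inf\|A\|\,\mathrm{Lip}(B)$, the infimum over all such factorizations; here $\|A\|=\sup\{\|A(x^1,\dots,x^n)\|:\|x^i\|\le1\}$ and $\mathrm{Lip}(B)$ is the least Lipschitz constant. $\Gamma(X_1,\dots,X_n;Y)$ is the collection of all $T$ that factor through a Hilbert space, with the norm $\Gamma(\cdot)$. *)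

theory Defs
  imports "HOL-Analysis.Analysis" "HOL-Algebra.Module"
begin

text \<open>
  Banach and Hilbert spaces are carrier-based structures over a scalar field
  \<open>K\<close> which is either \<open>\<real>\<close> or all of \<open>\<complex>\<close>, both viewed inside the type
  \<^typ>\<open>complex\<close>. Carriers are needed because the spaces \<open>X\<^sub>1, \<dots>, X\<^sub>n\<close> are unrelated to each
  other and because the factorization property quantifies existentially over a Hilbert space.
\<close>

definition scalar_ring :: "complex set \<Rightarrow> complex ring" where
  "scalar_ring K = \<lparr>carrier = K, mult = (*), one = 1, zero = 0, add = (+)\<rparr>"

text \<open>The fields \<open>mult\<close> and \<open>one\<close> inherited from the record \<open>module\<close> play no role.\<close>

record 'a nspace = "(complex, 'a) module" +
  nrm :: "'a \<Rightarrow> real"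

record 'a hspace = "'a nspace" +
  ip :: "'a \<Rightarrow> 'a \<Rightarrow> complex"

locale normed_space = Module.module "scalar_ring K" X
  for K :: "complex set" and X :: "('a, 'm) nspace_scheme" (structure) +
  assumes scalars: "K = \<real> \<or> K = UNIV"
    and nrm_nonneg: "x \<in> carrier X \<Longrightarrow> 0 \<le> nrm X x"
    and nrm_eq_zero: "x \<in> carrier X \<Longrightarrow> nrm X x = 0 \<Longrightarrow> x = \<zero>\<^bsub>X\<^esub>"
    and nrm_smult: "c \<in> K \<Longrightarrow> x \<in> carrier X \<Longrightarrow> nrm X (c \<odot>\<^bsub>X\<^esub> x) = cmod c * nrm X x"
    and nrm_triangle:
      "x \<in> carrier X \<Longrightarrow> y \<in> carrier X \<Longrightarrow> nrm X (x \<oplus>\<^bsub>X\<^esub> y) \<le> nrm X x + nrm X y"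

text \<open>
  The locale \<open>Metric_space\<close> demands nonnegativity and symmetry also off the carrier, hence the
  case distinction.
\<close>

definition norm_dist :: "('a, 'm) nspace_scheme \<Rightarrow> 'a \<Rightarrow> 'a \<Rightarrow> real" where
  "norm_dist X x y =
     (if x \<in> carrier X \<and> y \<in> carrier X then nrm X (x \<ominus>\<^bsub>X\<^esub> y) else 0)"

definition norm_metric :: "('a, 'm) nspace_scheme \<Rightarrow> 'a metric" where
  "norm_metric X = metric (carrier X, norm_dist X)"

lemma (in normed_space) Metric_space_norm_dist: "Metric_space (carrier X) (norm_dist X)"
proof -
  have m1: "-1 \<in> K" using scalars by auto
  have K1: "1 \<in> K" "0 \<in> K" using scalars by auto
  have neg1: "\<ominus>\<^bsub>scalar_ring K\<^esub> 1 = -1"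
  proof (rule R.minus_equality)
    show "- 1 \<oplus>\<^bsub>scalar_ring K\<^esub> 1 = \<zero>\<^bsub>scalar_ring K\<^esub>" by (simp add: scalar_ring_def)
  qed (use m1 K1 in \<open>auto simp: scalar_ring_def\<close>)
  have neg: "\<ominus>\<^bsub>X\<^esub> x = (-1) \<odot>\<^bsub>X\<^esub> x" if x: "x \<in> carrier X" for x
  proof -
    have "(\<ominus>\<^bsub>scalar_ring K\<^esub> 1) \<odot>\<^bsub>X\<^esub> x = \<ominus>\<^bsub>X\<^esub> (1 \<odot>\<^bsub>X\<^esub> x)"
      using smult_l_minus[of 1 x] x K1 by (simp add: scalar_ring_def)
    moreover have "1 \<odot>\<^bsub>X\<^esub> x = x" using smult_one[OF x] by (simp add: scalar_ring_def)
    ultimately show ?thesis by (simp add: neg1)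
  qed
  have nneg: "nrm X (\<ominus>\<^bsub>X\<^esub> x) = nrm X x" if "x \<in> carrier X" for x
    using nrm_smult[OF m1 that] by (simp add: neg that)
  have nz: "nrm X \<zero>\<^bsub>X\<^esub> = 0"
  proof -
    have "nrm X (0 \<odot>\<^bsub>X\<^esub> \<zero>\<^bsub>X\<^esub>) = 0" using nrm_smult[of 0 "\<zero>\<^bsub>X\<^esub>"] K1 by simp
    moreover have "0 \<odot>\<^bsub>X\<^esub> \<zero>\<^bsub>X\<^esub> = \<zero>\<^bsub>X\<^esub>" using smult_r_null[of 0] K1 by (simp add: scalar_ring_def)
    ultimately show ?thesis by simp
  qed
  show ?thesis
  proof
    show "0 \<le> norm_dist X x y" for x y
      by (auto simp: norm_dist_def nrm_nonneg)
    show "norm_dist X x y = norm_dist X y x" for x y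
    proof (cases "x \<in> carrier X \<and> y \<in> carrier X")
      case True
      then have "\<ominus>\<^bsub>X\<^esub> (x \<ominus>\<^bsub>X\<^esub> y) = y \<ominus>\<^bsub>X\<^esub> x"
        by (simp add: a_minus_def M.minus_add M.a_comm)
      then show ?thesis using True nneg[of "x \<ominus>\<^bsub>X\<^esub> y"] by (simp add: norm_dist_def)
    qed (auto simp: norm_dist_def)
    show "norm_dist X x y = 0 \<longleftrightarrow> x = y" if "x \<in> carrier X" "y \<in> carrier X" for x y
    proof
      assume "norm_dist X x y = 0"
      then have "x \<ominus>\<^bsub>X\<^esub> y = \<zero>\<^bsub>X\<^esub>" using that by (intro nrm_eq_zero) (auto simp: norm_dist_def)
      then show "x = y"
        using that by (metis M.minus_equality M.minus_minus a_minus_def M.a_inv_closed)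
    qed (use that nz in \<open>auto simp: norm_dist_def a_minus_def M.r_neg\<close>)
    show "norm_dist X x z \<le> norm_dist X x y + norm_dist X y z"
      if "x \<in> carrier X" "y \<in> carrier X" "z \<in> carrier X" for x y z
    proof -
      have "x \<ominus>\<^bsub>X\<^esub> z = (x \<ominus>\<^bsub>X\<^esub> y) \<oplus>\<^bsub>X\<^esub> (y \<ominus>\<^bsub>X\<^esub> z)"
        using that by (simp add: a_minus_def M.a_assoc M.r_neg1)
      then show ?thesis
        using that nrm_triangle[of "x \<ominus>\<^bsub>X\<^esub> y" "y \<ominus>\<^bsub>X\<^esub> z"] by (simp add: norm_dist_def)
    qed
  qed
qed

lemma (in normed_space) mspace_norm_metric [simp]: "mspace (norm_metric X) = carrier X"
  by (simp add: norm_metric_def Metric_space.mspace_metric[OF Metric_space_norm_dist])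

lemma (in normed_space) mdist_norm_metric [simp]: "mdist (norm_metric X) = norm_dist X"
  by (simp add: norm_metric_def Metric_space.mdist_metric[OF Metric_space_norm_dist])

locale banach_space = normed_space +
  assumes complete: "mcomplete_of (norm_metric X)"

locale hilbert_space = banach_space K H
  for K :: "complex set" and H :: "('a, 'm) hspace_scheme" (structure) +
  assumes ip_scalar: "x \<in> carrier H \<Longrightarrow> y \<in> carrier H \<Longrightarrow> ip H x y \<in> K"
    and ip_add: "x \<in> carrier H \<Longrightarrow> y \<in> carrier H \<Longrightarrow> z \<in> carrier H \<Longrightarrow>
      ip H (x \<oplus>\<^bsub>H\<^esub> y) z = ip H x z + ip H y z"
    and ip_smult: "c \<in> K \<Longrightarrow> x \<in> carrier H \<Longrightarrow> y \<in> carrier H \<Longrightarrow>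
      ip H (c \<odot>\<^bsub>H\<^esub> x) y = c * ip H x y"
    and ip_cnj: "x \<in> carrier H \<Longrightarrow> y \<in> carrier H \<Longrightarrow> ip H y x = cnj (ip H x y)"
    and ip_self: "x \<in> carrier H \<Longrightarrow> ip H x x = of_real ((nrm H x)\<^sup>2)"

text \<open>
  An \<open>n\<close>-tuple of spaces is a family over a finite index type \<open>'i\<close> with \<open>n\<close> elements. That all
  members have carriers in one type \<open>'a\<close> is no restriction, since they carry their own
  operations and unrelated carriers can be placed in a common disjoint union.
\<close>

abbreviation tuples :: "('i \<Rightarrow> ('a, 'm) nspace_scheme) \<Rightarrow> ('i \<Rightarrow> 'a) set" where
  "tuples X \<equiv> PiE UNIV (\<lambda>i. carrier (X i))"

definition multilinear_map ::
  "complex set \<Rightarrow> ('i::finite \<Rightarrow> ('a, 'm) nspace_scheme) \<Rightarrow> ('b, 'l) nspace_scheme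
    \<Rightarrow> (('i \<Rightarrow> 'a) \<Rightarrow> 'b) \<Rightarrow> bool" where
  "multilinear_map K X Y T \<longleftrightarrow>
     (\<forall>x\<in>tuples X. T x \<in> carrier Y) \<and>
     (\<forall>x\<in>tuples X. \<forall>i. \<forall>u\<in>carrier (X i). \<forall>v\<in>carrier (X i).
        T (x(i := u \<oplus>\<^bsub>X i\<^esub> v)) = T (x(i := u)) \<oplus>\<^bsub>Y\<^esub> T (x(i := v))) \<and>
     (\<forall>x\<in>tuples X. \<forall>i. \<forall>c\<in>K. \<forall>u\<in>carrier (X i).
        T (x(i := c \<odot>\<^bsub>X i\<^esub> u)) = c \<odot>\<^bsub>Y\<^esub> T (x(i := u)))"

definition unit_ball_norms ::
  "('i::finite \<Rightarrow> ('a, 'm) nspace_scheme) \<Rightarrow> ('b, 'l) nspace_scheme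
    \<Rightarrow> (('i \<Rightarrow> 'a) \<Rightarrow> 'b) \<Rightarrow> real set" where
  "unit_ball_norms X Y T = {nrm Y (T x) | x. x \<in> tuples X \<and> (\<forall>i. nrm (X i) (x i) \<le> 1)}"

definition bounded_multilinear_map ::
  "complex set \<Rightarrow> ('i::finite \<Rightarrow> ('a, 'm) nspace_scheme) \<Rightarrow> ('b, 'l) nspace_scheme
    \<Rightarrow> (('i \<Rightarrow> 'a) \<Rightarrow> 'b) \<Rightarrow> bool" where
  "bounded_multilinear_map K X Y T \<longleftrightarrow>
     multilinear_map K X Y T \<and> bdd_above (unit_ball_norms X Y T)"

definition mult_norm ::
  "('i::finite \<Rightarrow> ('a, 'm) nspace_scheme) \<Rightarrow> ('b, 'l) nspace_scheme
    \<Rightarrow> (('i \<Rightarrow> 'a) \<Rightarrow> 'b) \<Rightarrow> real" where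
  "mult_norm X Y T = Sup (unit_ball_norms X Y T)"

definition lin_span :: "complex set \<Rightarrow> ('a, 'm) nspace_scheme \<Rightarrow> 'a set \<Rightarrow> 'a set" where
  "lin_span K X S =
     {(\<Oplus>\<^bsub>X\<^esub>s\<in>F. c s \<odot>\<^bsub>X\<^esub> s) | F c. finite F \<and> F \<subseteq> S \<and> c \<in> F \<rightarrow> K}"

definition orthonormal_basis :: "complex set \<Rightarrow> ('a, 'm) hspace_scheme \<Rightarrow> 'a set \<Rightarrow> bool" where
  "orthonormal_basis K H E \<longleftrightarrow>
     E \<subseteq> carrier H \<and>
     (\<forall>e\<in>E. \<forall>f\<in>E. ip H e f = (if e = f then 1 else 0)) \<and>
     mtopology_of (norm_metric H) closure_of lin_span K H E = carrier H"

text \<open>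
  Hilbert--Schmidt operators and their norm, computed with the orthonormal bases \<open>E i\<close>; these are
  indexed by their own elements, so a multi-index is a tuple of basis vectors.
\<close>

definition hilbert_schmidt ::
  "complex set \<Rightarrow> ('i::finite \<Rightarrow> ('a, 'm) hspace_scheme) \<Rightarrow> ('b, 'l) nspace_scheme
    \<Rightarrow> ('i \<Rightarrow> 'a set) \<Rightarrow> (('i \<Rightarrow> 'a) \<Rightarrow> 'b) \<Rightarrow> bool" where
  "hilbert_schmidt K H Y E T \<longleftrightarrow>
     bounded_multilinear_map K H Y T \<and> (\<lambda>e. (nrm Y (T e))\<^sup>2) summable_on PiE UNIV E"

definition hs_norm ::
  "('b, 'l) nspace_scheme \<Rightarrow> ('i::finite \<Rightarrow> 'a set) \<Rightarrow> (('i \<Rightarrow> 'a) \<Rightarrow> 'b) \<Rightarrow> real" where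
  "hs_norm Y E T = sqrt (\<Sum>\<^sub>\<infinity>e\<in>PiE UNIV E. (nrm Y (T e))\<^sup>2)"

definition lip_const ::
  "('a, 'm) nspace_scheme \<Rightarrow> 'a set \<Rightarrow> ('b, 'l) nspace_scheme \<Rightarrow> ('a \<Rightarrow> 'b) \<Rightarrow> real" where
  "lip_const G M Y B =
     Inf {L. 0 \<le> L \<and> (\<forall>u\<in>M. \<forall>v\<in>M.
            mdist (norm_metric Y) (B u) (B v) \<le> L * mdist (norm_metric G) u v)}"

definition hilbert_factorization ::
  "complex set \<Rightarrow> ('i::finite \<Rightarrow> ('a, 'm) nspace_scheme) \<Rightarrow> ('b, 'l) nspace_scheme
    \<Rightarrow> (('i \<Rightarrow> 'a) \<Rightarrow> 'b) \<Rightarrow> ('g, 'k) hspace_scheme \<Rightarrow> 'g set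
    \<Rightarrow> (('i \<Rightarrow> 'a) \<Rightarrow> 'g) \<Rightarrow> ('g \<Rightarrow> 'b) \<Rightarrow> bool" where
  "hilbert_factorization K X Y T G M A B \<longleftrightarrow>
     hilbert_space K G \<and> M \<subseteq> carrier G \<and>
     bounded_multilinear_map K X G A \<and> A ` tuples X \<subseteq> M \<and>
     Lipschitz_continuous_map (submetric (norm_metric G) M) (norm_metric Y) B \<and>
     (\<forall>x\<in>tuples X. T x = B (A x))"

text \<open>
  HOL cannot quantify over types, so the carrier of \<open>G\<close> is taken inside the fixed type
  \<^typ>\<open>('i \<Rightarrow> 'a) \<Rightarrow> complex\<close>. This loses nothing: in a factorization through an arbitrary
  Hilbert space one may replace \<open>G\<close> by the closed linear span \<open>G'\<close> of the range of \<open>A\<close> and \<open>M\<close> by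
  \<open>M \<inter> G'\<close>, which does not increase \<open>\<parallel>A\<parallel> Lip(B)\<close>. A vector \<open>g\<close> of \<open>G'\<close> is determined by
  the function \<open>x \<mapsto> \<langle>g, A x\<rangle>\<close> on tuples (extended by 0), so \<open>G'\<close> has an isometric copy
  whose carrier consists of such functions.
\<close>

definition factors_through_hilbert ::
  "complex set \<Rightarrow> ('i::finite \<Rightarrow> ('a, 'm) nspace_scheme) \<Rightarrow> ('b, 'l) nspace_scheme
    \<Rightarrow> (('i \<Rightarrow> 'a) \<Rightarrow> 'b) \<Rightarrow> bool" where
  "factors_through_hilbert K X Y T \<longleftrightarrow>
     multilinear_map K X Y T \<and>
     (\<exists>(G :: (('i \<Rightarrow> 'a) \<Rightarrow> complex) hspace) M A B. hilbert_factorization K X Y T G M A B)"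

definition gamma_norm ::
  "complex set \<Rightarrow> ('i::finite \<Rightarrow> ('a, 'm) nspace_scheme) \<Rightarrow> ('b, 'l) nspace_scheme
    \<Rightarrow> (('i \<Rightarrow> 'a) \<Rightarrow> 'b) \<Rightarrow> real" where
  "gamma_norm K X Y T =
     Inf {mult_norm X G A * lip_const G M Y B |
            (G :: (('i \<Rightarrow> 'a) \<Rightarrow> complex) hspace) M A B. hilbert_factorization K X Y T G M A B}"

end

theory Submission
  imports Defs
begin

text \<open>
  \<open>T\<close> factors as the identity of \<open>H\<close> after \<open>T\<close> itself, which gives \<open>\<Gamma>(T) \<le> \<parallel>T\<parallel>\<close>; as the intermediate
  space has to live in the type \<^typ>\<open>('i \<Rightarrow> 'a) \<Rightarrow> complex\<close>, \<open>H\<close> is cut down to \<open>R\<^sup>\<bottom>\<^sup>\<bottom>\<close>, with \<open>R\<close> the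
  range of \<open>T\<close>, whose vectors \<open>g\<close> are determined by the functions \<open>x \<mapsto> \<langle>g, T x\<rangle>\<close>. It remains to see
  \<open>\<parallel>T\<parallel> \<le> \<parallel>T\<parallel>\<^sub>H\<^sub>S\<close>. For arguments in the linear spans of the bases this is the Cauchy--Schwarz
  inequality applied in one coordinate after the other; the general case follows by density,
  replacing the coordinates by general vectors one at a time, because a bounded multilinear map
  is Lipschitz in each coordinate.
\<close>

section \<open>Normed and Hilbert spaces\<close>

context normed_space
begin

text \<open>Later constructions divide by real norms and form differences, so each scalar used must
  be certified to lie in \<open>K\<close> when \<open>K\<close> is only the reals.\<close>

lemma one_scalar: "1 \<in> K" and zero_scalar: "0 \<in> K" and uminus_one_scalar: "- 1 \<in> K"
  and of_real_scalar: "of_real r \<in> K"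
  using scalars by auto

lemma uminus_scalar: "a \<in> K \<Longrightarrow> - a \<in> K"
  and divide_of_real_scalar: "a \<in> K \<Longrightarrow> a / of_real r \<in> K"
  using scalars by auto

lemma smult_mem: "c \<in> K \<Longrightarrow> x \<in> carrier X \<Longrightarrow> c \<odot>\<^bsub>X\<^esub> x \<in> carrier X"
  using smult_closed[of c x] by (simp add: scalar_ring_def)

lemma smult_zero_scalar: "x \<in> carrier X \<Longrightarrow> 0 \<odot>\<^bsub>X\<^esub> x = \<zero>\<^bsub>X\<^esub>"
  using smult_l_null[of x] by (simp add: scalar_ring_def)

lemma smult_one_scalar: "x \<in> carrier X \<Longrightarrow> 1 \<odot>\<^bsub>X\<^esub> x = x"
  using smult_one[of x] by (simp add: scalar_ring_def)

lemma add_smult_uminus: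
  assumes "x \<in> carrier X"
  shows "(- 1) \<odot>\<^bsub>X\<^esub> x \<oplus>\<^bsub>X\<^esub> x = \<zero>\<^bsub>X\<^esub>"
  using smult_l_distr[of "- 1" 1 x] assms
  by (simp add: scalar_ring_def one_scalar uminus_one_scalar smult_zero_scalar[unfolded scalar_ring_def]
      smult_one_scalar[unfolded scalar_ring_def])

lemma a_inv_eq_smult: "x \<in> carrier X \<Longrightarrow> \<ominus>\<^bsub>X\<^esub> x = (- 1) \<odot>\<^bsub>X\<^esub> x"
  by (rule M.minus_equality) (simp_all add: add_smult_uminus smult_mem uminus_one_scalar)

lemma nrm_zero: "nrm X \<zero>\<^bsub>X\<^esub> = 0"
  using nrm_smult[of 0 "\<zero>\<^bsub>X\<^esub>"] by (simp add: smult_zero_scalar zero_scalar)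

lemma nrm_minus_commute:
  "x \<in> carrier X \<Longrightarrow> y \<in> carrier X \<Longrightarrow> nrm X (x \<ominus>\<^bsub>X\<^esub> y) = nrm X (y \<ominus>\<^bsub>X\<^esub> x)"
  using Metric_space.commute[OF Metric_space_norm_dist, of x y] by (simp add: norm_dist_def)

lemma minus_add_cancel:
  "x \<in> carrier X \<Longrightarrow> y \<in> carrier X \<Longrightarrow> (x \<ominus>\<^bsub>X\<^esub> y) \<oplus>\<^bsub>X\<^esub> y = x"
  by (simp add: a_minus_def M.a_assoc M.l_neg)

end

context hilbert_space
begin

lemma ip_zero: "y \<in> carrier H \<Longrightarrow> ip H \<zero>\<^bsub>H\<^esub> y = 0"
  using ip_smult[of 0 "\<zero>\<^bsub>H\<^esub>" y] by (simp add: smult_zero_scalar zero_scalar)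

lemma ip_minus:
  "x \<in> carrier H \<Longrightarrow> y \<in> carrier H \<Longrightarrow> z \<in> carrier H \<Longrightarrow>
    ip H (x \<ominus>\<^bsub>H\<^esub> y) z = ip H x z - ip H y z"
  using ip_add[of "x \<ominus>\<^bsub>H\<^esub> y" y z] by (simp add: minus_add_cancel)

text \<open>For \<open>y\<close> nonzero, subtract from \<open>x\<close> its projection onto the
  line of \<open>y\<close> and use that the squared norm of the remainder is nonnegative. A vector
  of norm zero is the zero vector, which makes the other case trivial.\<close>

lemma Cauchy_Schwarz:
  assumes x: "x \<in> carrier H" and y: "y \<in> carrier H"
  shows "cmod (ip H x y) \<le> nrm H x * nrm H y"
proof (cases "nrm H y = 0")
  case True
  then have "y = \<zero>\<^bsub>H\<^esub>" using nrm_eq_zero y by blast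
  then have "ip H x y = 0" using ip_cnj[OF y x] ip_zero[OF x] by simp
  then show ?thesis by (simp add: True)
next
  case False
  define p where "p = ip H x y"
  define b where "b = (nrm H y)\<^sup>2"
  have b: "b > 0" using False by (simp add: b_def)
  \<comment> \<open>This coefficient makes \<open>x\<close> plus \<open>d\<close> times
    \<open>y\<close> orthogonal to \<open>y\<close>. It stays in \<open>K\<close> because
    \<open>p\<close> is an inner product and \<open>b\<close> is real.\<close>
  define d where "d = - p / of_real b"
  have d: "d \<in> K" unfolding d_def p_def
    by (intro divide_of_real_scalar uminus_scalar ip_scalar x y)
  define w where "w = d \<odot>\<^bsub>H\<^esub> y"
  have w: "w \<in> carrier H" unfolding w_def using d y by (rule smult_mem)
  have wz: "ip H w z = d * ip H y z" if "z \<in> carrier H" for z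
    unfolding w_def using ip_smult[OF d y that] .
  have zw: "ip H z w = cnj d * ip H z y" if "z \<in> carrier H" for z
    using ip_cnj[OF w that] wz[OF that] ip_cnj[OF that y] by simp
  have xw: "x \<oplus>\<^bsub>H\<^esub> w \<in> carrier H" using x w by simp
  \<comment> \<open>Additivity is available in the first argument only; conjugate symmetry carries
    it over to the second, whence the outer conjugates.\<close>
  have "ip H (x \<oplus>\<^bsub>H\<^esub> w) (x \<oplus>\<^bsub>H\<^esub> w) = cnj (ip H x x + ip H w x) + cnj (ip H x w + ip H w w)"
    by (metis ip_add ip_cnj x w xw)
  also have "\<dots> = of_real ((nrm H x)\<^sup>2) + cnj d * p + d * cnj p + d * cnj d * of_real b"
    using wz[OF x] zw[OF x] wz[OF w] zw[OF y] ip_self[OF x] ip_self[OF y] ip_cnj[OF x y]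
    by (simp add: p_def b_def)
  also have "\<dots> = of_real ((nrm H x)\<^sup>2 - (cmod p)\<^sup>2 / b)"
    using b by (simp add: d_def field_simps complex_norm_square del: of_real_power)
  finally have "(nrm H (x \<oplus>\<^bsub>H\<^esub> w))\<^sup>2 = (nrm H x)\<^sup>2 - (cmod p)\<^sup>2 / b"
    using ip_self[OF xw] of_real_eq_iff[where 'a=complex] by metis
  then have "(cmod p)\<^sup>2 / b \<le> (nrm H x)\<^sup>2"
    using zero_le_power2[of "nrm H (x \<oplus>\<^bsub>H\<^esub> w)"] by linarith
  then have "(cmod p)\<^sup>2 \<le> (nrm H x * nrm H y)\<^sup>2"
    using b by (simp add: field_simps b_def power_mult_distrib)
  then show ?thesis
    unfolding p_def by (rule power2_le_imp_le) (simp add: nrm_nonneg x y)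
qed

text \<open>Pythagoras: pairing the sum with a basis vector isolates one coefficient, and expanding
  the first argument of the self-pairing then leaves the squares.\<close>

lemma orthonormal_sum:
  assumes "finite F" "F \<subseteq> carrier H" "c \<in> F \<rightarrow> K"
    and orth: "\<And>e f. e \<in> F \<Longrightarrow> f \<in> F \<Longrightarrow> ip H e f = (if e = f then 1 else 0)"
  shows "(nrm H (\<Oplus>\<^bsub>H\<^esub>s\<in>F. c s \<odot>\<^bsub>H\<^esub> s))\<^sup>2 = (\<Sum>s\<in>F. (cmod (c s))\<^sup>2)"
proof -
  have mem: "(\<Oplus>\<^bsub>H\<^esub>s\<in>A. c s \<odot>\<^bsub>H\<^esub> s) \<in> carrier H" if "A \<subseteq> F" for A
    using assms that by (intro M.finsum_closed) (auto intro!: smult_mem)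
  \<comment> \<open>Stated for all subsets \<open>A\<close> of \<open>F\<close> so that the
    induction can build the sum one summand at a time; only \<open>A = F\<close> is used
    afterwards.\<close>
  have ipl: "ip H (\<Oplus>\<^bsub>H\<^esub>s\<in>A. c s \<odot>\<^bsub>H\<^esub> s) z = (\<Sum>s\<in>A. c s * ip H s z)"
    if "A \<subseteq> F" "z \<in> carrier H" for A z
    using finite_subset[OF \<open>A \<subseteq> F\<close> \<open>finite F\<close>] that(1)
  proof (induction A rule: finite_induct)
    case empty
    then show ?case using that by (simp add: ip_zero)
  next
    case (insert a A)
    have a: "c a \<odot>\<^bsub>H\<^esub> a \<in> carrier H" "c a \<in> K" "a \<in> carrier H"
      using insert assms by (auto intro!: smult_mem)
    have "(\<Oplus>\<^bsub>H\<^esub>s\<in>insert a A. c s \<odot>\<^bsub>H\<^esub> s) = c a \<odot>\<^bsub>H\<^esub> a \<oplus>\<^bsub>H\<^esub> (\<Oplus>\<^bsub>H\<^esub>s\<in>A. c s \<odot>\<^bsub>H\<^esub> s)"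
      using insert assms by (intro M.finsum_insert) (auto intro!: smult_mem)
    then show ?case using insert a that mem[of A] by (simp add: ip_add ip_smult)
  qed
  define v where "v = (\<Oplus>\<^bsub>H\<^esub>s\<in>F. c s \<odot>\<^bsub>H\<^esub> s)"
  have v: "v \<in> carrier H" unfolding v_def by (rule mem) simp
  have sv: "ip H s v = cnj (c s)" if "s \<in> F" for s
  proof -
    have s: "s \<in> carrier H" using that assms by auto
    have "ip H v s = (\<Sum>t\<in>F. c t * ip H t s)" unfolding v_def by (rule ipl) (use s in auto)
    also have "\<dots> = (\<Sum>t\<in>F. if t = s then c t else 0)"
      by (rule sum.cong) (auto simp: orth that)
    also have "\<dots> = c s" using that assms by simp
    finally show ?thesis using ip_cnj[OF v s] by simp
  qed
  have "of_real ((nrm H v)\<^sup>2) = ip H v v" using ip_self[OF v] by simp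
  also have "\<dots> = (\<Sum>s\<in>F. c s * ip H s v)" unfolding v_def by (rule ipl) (use v v_def in auto)
  also have "\<dots> = (\<Sum>s\<in>F. of_real ((cmod (c s))\<^sup>2))"
    by (rule sum.cong) (auto simp: sv complex_norm_square simp del: of_real_power)
  finally have "complex_of_real ((nrm H v)\<^sup>2) = of_real (\<Sum>s\<in>F. (cmod (c s))\<^sup>2)" by simp
  then show ?thesis unfolding v_def of_real_eq_iff .
qed

end

section \<open>Orthogonal complements\<close>

definition annihilator :: "('b, 'm) hspace_scheme \<Rightarrow> 'b set \<Rightarrow> 'b set" where
  "annihilator H A = {g \<in> carrier H. \<forall>a\<in>A. ip H g a = 0}"

context hilbert_space
begin

lemma annihilator_subspace:
  assumes "A \<subseteq> carrier H"
  shows "\<zero>\<^bsub>H\<^esub> \<in> annihilator H A"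
    and "x \<in> annihilator H A \<Longrightarrow> y \<in> annihilator H A \<Longrightarrow> x \<oplus>\<^bsub>H\<^esub> y \<in> annihilator H A"
    and "c \<in> K \<Longrightarrow> x \<in> annihilator H A \<Longrightarrow> c \<odot>\<^bsub>H\<^esub> x \<in> annihilator H A"
  using assms by (auto simp: annihilator_def ip_zero ip_add ip_smult smult_mem subset_iff)

text \<open>By Cauchy-Schwarz, pairing with a fixed vector is continuous, so its zero set is closed
  under limits of sequences.\<close>

lemma closedin_annihilator:
  assumes "A \<subseteq> carrier H"
  shows "closedin (mtopology_of (norm_metric H)) (annihilator H A)"
proof -
  interpret H: Metric_space "carrier H" "norm_dist H" by (rule Metric_space_norm_dist)
  have "closedin H.mtopology (annihilator H A)"
    unfolding H.metric_closedin_iff_sequentially_closed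
  proof (intro conjI allI impI)
    show "annihilator H A \<subseteq> carrier H" by (auto simp: annihilator_def)
    fix \<sigma> l assume "range \<sigma> \<subseteq> annihilator H A \<and> limitin H.mtopology \<sigma> l sequentially"
    then have \<sigma>: "\<And>n. \<sigma> n \<in> annihilator H A" and l: "l \<in> carrier H"
      and lim: "\<And>\<epsilon>. \<epsilon> > 0 \<Longrightarrow> \<exists>N. \<forall>n\<ge>N. norm_dist H (\<sigma> n) l < \<epsilon>"
      unfolding H.limit_metric_sequentially by blast+
    have "ip H l a = 0" if "a \<in> A" for a
    proof -
      have a: "a \<in> carrier H" using that assms by blast
      \<comment> \<open>The summand 0 fits \<open>field_le_epsilon\<close>. Below, the tolerance is
        divided by \<open>nrm H a + 1\<close>, which is positive even when \<open>a\<close> is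
        zero.\<close>
      have "cmod (ip H l a) \<le> 0 + e" if "e > 0" for e
      proof -
        have n0: "nrm H a \<ge> 0" using a by (rule nrm_nonneg)
        then obtain N where N: "norm_dist H (\<sigma> N) l < e / (nrm H a + 1)"
          using lim[of "e / (nrm H a + 1)"] \<open>e > 0\<close> by auto
        have sN: "\<sigma> N \<in> carrier H" "ip H (\<sigma> N) a = 0"
          using \<sigma>[of N] \<open>a \<in> A\<close> by (auto simp: annihilator_def)
        \<comment> \<open>The term \<open>\<sigma> N\<close> is annihilated by \<open>a\<close>, so
          the pairing of \<open>l\<close> depends only on the small difference.\<close>
        then have "ip H l a = - ip H (\<sigma> N \<ominus>\<^bsub>H\<^esub> l) a" using ip_minus[OF _ l a] by simp
        then have "cmod (ip H l a) \<le> nrm H (\<sigma> N \<ominus>\<^bsub>H\<^esub> l) * nrm H a"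
          using Cauchy_Schwarz[OF _ a] sN l by simp
        also have "\<dots> \<le> e / (nrm H a + 1) * nrm H a"
          using N sN l n0 by (intro mult_right_mono) (auto simp: norm_dist_def)
        also have "\<dots> \<le> e" using n0 \<open>e > 0\<close> by (simp add: field_simps)
        finally show ?thesis by simp
      qed
      then have "cmod (ip H l a) \<le> 0" by (rule field_le_epsilon)
      then show ?thesis by simp
    qed
    then show "l \<in> annihilator H A" using l by (simp add: annihilator_def)
  qed
  then show ?thesis by (simp add: mtopology_of_def)
qed

text \<open>Such a vector is orthogonal to itself. Applied with \<open>A\<close> an annihilator,
  this says that the complement and the double complement of a set meet only in zero.\<close>

lemma annihilator_self_zero:
  assumes "x \<in> annihilator H A" "x \<in> A"
  shows "x = \<zero>\<^bsub>H\<^esub>"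
proof -
  have x: "x \<in> carrier H" "ip H x x = 0" using assms by (auto simp: annihilator_def)
  then have "nrm H x = 0" using ip_self[OF x(1)] by simp
  then show ?thesis using x nrm_eq_zero by blast
qed

end

section \<open>Bounded multilinear operators\<close>

locale multilinear_operator =
  fixes K :: "complex set"
    and X :: "'i::finite \<Rightarrow> ('a, 'm) nspace_scheme"
    and Y :: "('b, 'l) nspace_scheme"
    and T :: "('i \<Rightarrow> 'a) \<Rightarrow> 'b"
  assumes normed_X: "normed_space K (X i)"
    and normed_Y: "normed_space K Y"
    and multilinear: "multilinear_map K X Y T"
begin

sublocale X: normed_space K "X i" for i by (rule normed_X)
sublocale Y: normed_space K Y by (rule normed_Y)

lemma closed: "x \<in> tuples X \<Longrightarrow> T x \<in> carrier Y"
  and add: "x \<in> tuples X \<Longrightarrow> u \<in> carrier (X i) \<Longrightarrow> v \<in> carrier (X i) \<Longrightarrow>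
    T (x(i := u \<oplus>\<^bsub>X i\<^esub> v)) = T (x(i := u)) \<oplus>\<^bsub>Y\<^esub> T (x(i := v))"
  and smult: "x \<in> tuples X \<Longrightarrow> c \<in> K \<Longrightarrow> u \<in> carrier (X i) \<Longrightarrow>
    T (x(i := c \<odot>\<^bsub>X i\<^esub> u)) = c \<odot>\<^bsub>Y\<^esub> T (x(i := u))"
  using multilinear unfolding multilinear_map_def by blast+

lemma upd_tuples: "x \<in> tuples X \<Longrightarrow> u \<in> carrier (X i) \<Longrightarrow> x(i := u) \<in> tuples X"
  by (auto simp: PiE_iff)

lemma zero_coordinate:
  assumes "x \<in> tuples X" "x i = \<zero>\<^bsub>X i\<^esub>"
  shows "T x = \<zero>\<^bsub>Y\<^esub>"
proof -
  have "T (x(i := 0 \<odot>\<^bsub>X i\<^esub> \<zero>\<^bsub>X i\<^esub>)) = 0 \<odot>\<^bsub>Y\<^esub> T (x(i := \<zero>\<^bsub>X i\<^esub>))"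
    using assms by (intro smult) (auto simp: Y.zero_scalar)
  moreover have "x(i := \<zero>\<^bsub>X i\<^esub>) = x" using assms by auto
  ultimately show ?thesis
    using assms closed by (simp add: X.smult_zero_scalar Y.smult_zero_scalar)
qed

text \<open>Homogeneity in several coordinates at once: \<open>S\<close> collects the coordinates
  already scaled, and each induction step pulls out one scalar.\<close>

lemma nrm_scale:
  assumes x: "x \<in> tuples X" and c: "\<And>i. c i \<in> K"
  shows "nrm Y (T (\<lambda>i. if i \<in> S then c i \<odot>\<^bsub>X i\<^esub> x i else x i)) = (\<Prod>i\<in>S. cmod (c i)) * nrm Y (T x)"
  using finite[of S]
proof (induction S rule: finite_induct)
  case empty
  then show ?case by simp
next
  case (insert j S)
  let ?y = "\<lambda>i. if i \<in> S then c i \<odot>\<^bsub>X i\<^esub> x i else x i"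
  have y: "?y \<in> tuples X" using x c by (auto simp: PiE_iff X.smult_mem)
  have xj: "x j \<in> carrier (X j)" using x by (auto simp: PiE_iff)
  have yj: "?y(j := x j) = ?y" using insert by auto
  have "(\<lambda>i. if i \<in> insert j S then c i \<odot>\<^bsub>X i\<^esub> x i else x i) = ?y(j := c j \<odot>\<^bsub>X j\<^esub> x j)"
    using insert by auto
  then have "T (\<lambda>i. if i \<in> insert j S then c i \<odot>\<^bsub>X i\<^esub> x i else x i) = c j \<odot>\<^bsub>Y\<^esub> T ?y"
    by (simp only: smult[OF y c xj] yj)
  then show ?case using insert Y.nrm_smult[OF c closed[OF y]] by simp
qed

text \<open>Together with boundedness this makes the supremum in \<open>mult_norm\<close> a genuine
  one; the zero tuple is the witness.\<close>

lemma unit_ball_norms_nonempty: "unit_ball_norms X Y T \<noteq> {}"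
proof -
  have "nrm Y (T (\<lambda>i. \<zero>\<^bsub>X i\<^esub>)) \<in> unit_ball_norms X Y T"
    unfolding unit_ball_norms_def by (rule CollectI, rule exI[of _ "\<lambda>i. \<zero>\<^bsub>X i\<^esub>"]) (auto simp: X.nrm_zero)
  then show ?thesis by blast
qed

lemma mult_norm_nonneg:
  assumes "bdd_above (unit_ball_norms X Y T)"
  shows "0 \<le> mult_norm X Y T"
proof -
  obtain t where t: "t \<in> unit_ball_norms X Y T" using unit_ball_norms_nonempty by blast
  then have "0 \<le> t" unfolding unit_ball_norms_def using Y.nrm_nonneg closed by blast
  also have "t \<le> mult_norm X Y T" unfolding mult_norm_def using t assms by (rule cSup_upper)
  finally show ?thesis .
qed

text \<open>Normalizing every coordinate moves the tuple into the unit ball, and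
  \<open>nrm_scale\<close> restores the norms. If some coordinate has norm zero, normalization is
  impossible but both sides vanish.\<close>

lemma nrm_le_mult_norm:
  assumes bdd: "bdd_above (unit_ball_norms X Y T)" and x: "x \<in> tuples X"
  shows "nrm Y (T x) \<le> mult_norm X Y T * (\<Prod>i\<in>UNIV. nrm (X i) (x i))"
proof (cases "\<exists>i. nrm (X i) (x i) = 0")
  case True
  then obtain i where i: "nrm (X i) (x i) = 0" by blast
  then have "x i = \<zero>\<^bsub>X i\<^esub>" using X.nrm_eq_zero x by (auto simp: PiE_iff)
  then have "nrm Y (T x) = 0" using zero_coordinate[OF x] Y.nrm_zero by simp
  moreover have "(\<Prod>i\<in>UNIV. nrm (X i) (x i)) = 0" using i by (auto intro!: prod_zero)
  ultimately show ?thesis by (simp only: mult_zero_right order_refl)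
next
  case False
  have xi: "x i \<in> carrier (X i)" for i using x by (auto simp: PiE_iff)
  have pos: "nrm (X i) (x i) > 0" for i using False X.nrm_nonneg[OF xi] by (metis order_le_less)
  define c where "c i = complex_of_real (1 / nrm (X i) (x i))" for i
  have c: "c i \<in> K" for i unfolding c_def by (rule Y.of_real_scalar)
  have cm: "cmod (c i) = 1 / nrm (X i) (x i)" for i using pos[of i] by (simp add: c_def norm_divide)
  let ?y = "\<lambda>i. c i \<odot>\<^bsub>X i\<^esub> x i"
  have "nrm (X i) (?y i) = 1" for i using X.nrm_smult[OF c xi] pos[of i] cm by simp
  moreover have "?y \<in> tuples X" using c xi by (auto simp: X.smult_mem)
  ultimately have "nrm Y (T ?y) \<in> unit_ball_norms X Y T"
    unfolding unit_ball_norms_def by (intro CollectI exI[of _ ?y]) simp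
  then have "nrm Y (T ?y) \<le> mult_norm X Y T" unfolding mult_norm_def using bdd by (rule cSup_upper)
  moreover have "nrm Y (T ?y) = (\<Prod>i\<in>UNIV. cmod (c i)) * nrm Y (T x)"
    using nrm_scale[OF x c, of UNIV] by simp
  moreover have "(\<Prod>i\<in>UNIV. cmod (c i)) = 1 / (\<Prod>i\<in>UNIV. nrm (X i) (x i))"
    unfolding cm by (simp add: prod_dividef)
  moreover have "(\<Prod>i\<in>UNIV. nrm (X i) (x i)) > 0" by (intro prod_pos ballI pos)
  ultimately show ?thesis by (simp add: field_simps)
qed

text \<open>The value at \<open>u\<close> splits additively into the values at \<open>u - v\<close>
  and at \<open>v\<close>; the first is controlled by the operator norm. This is the Lipschitz
  estimate behind the density argument.\<close>

lemma nrm_change_coordinate: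
  assumes bdd: "bdd_above (unit_ball_norms X Y T)" and x: "x \<in> tuples X"
    and u: "u \<in> carrier (X j)" and v: "v \<in> carrier (X j)"
  shows "nrm Y (T (x(j := u))) \<le> nrm Y (T (x(j := v))) +
    mult_norm X Y T * (\<Prod>i\<in>UNIV - {j}. nrm (X i) (x i)) * nrm (X j) (u \<ominus>\<^bsub>X j\<^esub> v)"
proof -
  let ?d = "u \<ominus>\<^bsub>X j\<^esub> v"
  have d: "?d \<in> carrier (X j)" using u v by simp
  note up = upd_tuples[OF x]
  have "T (x(j := u)) = T (x(j := ?d)) \<oplus>\<^bsub>Y\<^esub> T (x(j := v))"
    using add[OF x d v] by (simp add: X.minus_add_cancel u v)
  then have "nrm Y (T (x(j := u))) \<le> nrm Y (T (x(j := ?d))) + nrm Y (T (x(j := v)))"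
    using Y.nrm_triangle closed up d v by simp
  moreover have "nrm Y (T (x(j := ?d)))
      \<le> mult_norm X Y T * (\<Prod>i\<in>UNIV. nrm (X i) ((x(j := ?d)) i))"
    by (rule nrm_le_mult_norm[OF bdd up[OF d]])
  moreover have "(\<Prod>i\<in>UNIV. nrm (X i) ((x(j := ?d)) i))
      = nrm (X j) ?d * (\<Prod>i\<in>UNIV - {j}. nrm (X i) (x i))"
    by (subst prod.remove[of _ j]) (auto intro!: prod.cong)
  ultimately show ?thesis by (simp add: mult_ac)
qed

lemma nrm_coordinate_sum:
  assumes x: "x \<in> tuples X" and F: "finite F" "F \<subseteq> carrier (X j)" "c \<in> F \<rightarrow> K"
  shows "nrm Y (T (x(j := \<Oplus>\<^bsub>X j\<^esub>s\<in>F. c s \<odot>\<^bsub>X j\<^esub> s))) \<le> (\<Sum>s\<in>F. cmod (c s) * nrm Y (T (x(j := s))))"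
  using F
proof (induction F rule: finite_induct)
  case empty
  have "T (x(j := \<zero>\<^bsub>X j\<^esub>)) = \<zero>\<^bsub>Y\<^esub>"
    by (rule zero_coordinate[of _ j]) (use x in \<open>auto intro: upd_tuples\<close>)
  then show ?case by (simp only: X.M.finsum_empty Y.nrm_zero sum.empty order_refl)
next
  case (insert a A)
  let ?v = "\<Oplus>\<^bsub>X j\<^esub>s\<in>A. c s \<odot>\<^bsub>X j\<^esub> s"
  have a: "c a \<odot>\<^bsub>X j\<^esub> a \<in> carrier (X j)" "c a \<in> K" "a \<in> carrier (X j)"
    using insert by (auto intro!: X.smult_mem)
  have v: "?v \<in> carrier (X j)"
    using insert by (intro X.M.finsum_closed) (auto intro!: X.smult_mem)
  have "(\<Oplus>\<^bsub>X j\<^esub>s\<in>insert a A. c s \<odot>\<^bsub>X j\<^esub> s) = c a \<odot>\<^bsub>X j\<^esub> a \<oplus>\<^bsub>X j\<^esub> ?v"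
    using insert by (intro X.M.finsum_insert) (auto intro!: X.smult_mem)
  then have "T (x(j := \<Oplus>\<^bsub>X j\<^esub>s\<in>insert a A. c s \<odot>\<^bsub>X j\<^esub> s))
      = c a \<odot>\<^bsub>Y\<^esub> T (x(j := a)) \<oplus>\<^bsub>Y\<^esub> T (x(j := ?v))"
    using add[OF x a(1) v] smult[OF x a(2,3)] by simp
  moreover have "T (x(j := a)) \<in> carrier Y" "T (x(j := ?v)) \<in> carrier Y"
    using closed upd_tuples[OF x] a v by blast+
  ultimately have "nrm Y (T (x(j := \<Oplus>\<^bsub>X j\<^esub>s\<in>insert a A. c s \<odot>\<^bsub>X j\<^esub> s)))
      \<le> cmod (c a) * nrm Y (T (x(j := a))) + nrm Y (T (x(j := ?v)))"
    using Y.nrm_triangle[of "c a \<odot>\<^bsub>Y\<^esub> T (x(j := a))" "T (x(j := ?v))"] a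
    by (simp add: Y.nrm_smult Y.smult_mem)
  also have "\<dots> \<le> cmod (c a) * nrm Y (T (x(j := a))) + (\<Sum>s\<in>A. cmod (c s) * nrm Y (T (x(j := s))))"
    using insert.prems by (intro add_left_mono insert.IH) auto
  also have "\<dots> = (\<Sum>s\<in>insert a A. cmod (c s) * nrm Y (T (x(j := s))))"
    by (rule sum.insert[OF insert.hyps, symmetric])
  finally show ?case .
qed

end

section \<open>The operator norm is at most the Hilbert--Schmidt norm\<close>

text \<open>Induction on the set \<open>S\<close> of coordinates that have been expanded in their
  bases. Expanding a further coordinate costs one use of Cauchy-Schwarz, whose coefficient sum is
  the squared norm of that coordinate. For \<open>S\<close> the full index set, only tuples of basis
  vectors remain.\<close>

lemma nrm_le_hs_on_spans:
  fixes X :: "'i::finite \<Rightarrow> ('a, 'm) hspace_scheme"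
  assumes hilbert: "\<And>i. hilbert_space K (X i)" and T: "multilinear_operator K X Y T"
    and fin: "\<And>i. finite (F i)" and sub: "\<And>i. F i \<subseteq> carrier (X i)"
    and orth: "\<And>i e f. e \<in> F i \<Longrightarrow> f \<in> F i \<Longrightarrow> ip (X i) e f = (if e = f then 1 else 0)"
    and c: "\<And>i. c i \<in> F i \<rightarrow> K"
    and x: "x \<in> tuples X" and xi: "\<And>i. i \<in> S \<Longrightarrow> x i = (\<Oplus>\<^bsub>X i\<^esub>s\<in>F i. c i s \<odot>\<^bsub>X i\<^esub> s)"
  shows "(nrm Y (T x))\<^sup>2
    \<le> (\<Prod>i\<in>S. (nrm (X i) (x i))\<^sup>2) * (\<Sum>e\<in>PiE S F. (nrm Y (T (override_on x e S)))\<^sup>2)"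
  using finite[of S] xi
proof (induction S rule: finite_induct)
  case empty
  then show ?case by simp
next
  case (insert j S)
  interpret T: multilinear_operator K X Y T by (rule T)
  \<comment> \<open>The estimate for a single coordinate, with the others frozen at an arbitrary
    tuple; below they are the partially expanded tuples.\<close>
  have one: "(nrm Y (T (y(j := x j))))\<^sup>2
      \<le> (nrm (X j) (x j))\<^sup>2 * (\<Sum>s\<in>F j. (nrm Y (T (y(j := s))))\<^sup>2)" if y: "y \<in> tuples X" for y
  proof -
    have xj: "x j = (\<Oplus>\<^bsub>X j\<^esub>s\<in>F j. c j s \<odot>\<^bsub>X j\<^esub> s)" using insert by simp
    have mem: "T (y(j := u)) \<in> carrier Y" if "u \<in> carrier (X j)" for u
      using T.closed T.upd_tuples[OF y] that by blast
    have xjm: "x j \<in> carrier (X j)" using x by (auto simp: PiE_iff)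
    have "nrm Y (T (y(j := x j))) \<le> (\<Sum>s\<in>F j. cmod (c j s) * nrm Y (T (y(j := s))))"
      unfolding xj by (rule T.nrm_coordinate_sum[OF y fin sub c])
    then have "(nrm Y (T (y(j := x j))))\<^sup>2 \<le> (\<Sum>s\<in>F j. cmod (c j s) * nrm Y (T (y(j := s))))\<^sup>2"
      by (rule power_mono) (rule T.Y.nrm_nonneg[OF mem[OF xjm]])
    also have "\<dots> \<le> (\<Sum>s\<in>F j. (cmod (c j s))\<^sup>2) * (\<Sum>s\<in>F j. (nrm Y (T (y(j := s))))\<^sup>2)"
      by (rule Cauchy_Schwarz_ineq_sum)
    also have "(\<Sum>s\<in>F j. (cmod (c j s))\<^sup>2) = (nrm (X j) (x j))\<^sup>2"
      unfolding xj
      by (rule hilbert_space.orthonormal_sum[OF hilbert fin sub c, symmetric]) (rule orth)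
    finally show ?thesis .
  qed
  have ov: "override_on x e S \<in> tuples X" if "e \<in> PiE S F" for e
  proof (intro PiE_I)
    fix i
    show "override_on x e S i \<in> carrier (X i)"
      using that x sub[of i] by (cases "i \<in> S") (auto simp: override_on_def PiE_iff)
  qed simp
  \<comment> \<open>Coordinate \<open>j\<close> is not in \<open>S\<close>, so it still holds
    \<open>x j\<close>, and \<open>one\<close> applies to the overridden tuple as it stands.\<close>
  have ovj: "(override_on x e S)(j := x j) = override_on x e S" for e
    using insert by (auto simp: override_on_def)
  have ovs: "(override_on x e S)(j := s) = override_on x (e(j := s)) (insert j S)" for e s
    using insert by (auto simp: override_on_def)
  let ?P = "\<Prod>i\<in>S. (nrm (X i) (x i))\<^sup>2"
  have P: "?P \<ge> 0" by (intro prod_nonneg) auto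
  have "(nrm Y (T x))\<^sup>2 \<le> ?P * (\<Sum>e\<in>PiE S F. (nrm Y (T (override_on x e S)))\<^sup>2)"
    using insert by simp
  also have "\<dots> \<le> ?P * (\<Sum>e\<in>PiE S F. (nrm (X j) (x j))\<^sup>2 *
      (\<Sum>s\<in>F j. (nrm Y (T (override_on x (e(j := s)) (insert j S))))\<^sup>2))"
    using one[OF ov, unfolded ovj, unfolded ovs] by (intro mult_left_mono sum_mono P)
  also have "\<dots> = (nrm (X j) (x j))\<^sup>2 * ?P *
      (\<Sum>e\<in>PiE S F. \<Sum>s\<in>F j. (nrm Y (T (override_on x (e(j := s)) (insert j S))))\<^sup>2)"
    unfolding sum_distrib_left[symmetric] by (simp only: mult_ac)
  also have "(\<Sum>e\<in>PiE S F. \<Sum>s\<in>F j. (nrm Y (T (override_on x (e(j := s)) (insert j S))))\<^sup>2)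
      = (\<Sum>e\<in>PiE (insert j S) F. (nrm Y (T (override_on x e (insert j S))))\<^sup>2)"
    (is "(\<Sum>e\<in>_. \<Sum>s\<in>_. ?f (e(j := s))) = _")
  proof -
    \<comment> \<open>A tuple over \<open>insert j S\<close> is a basis vector at \<open>j\<close>
      together with a tuple over \<open>S\<close>, so the iterated sum is a single sum after
      reindexing.\<close>
    have "(\<Sum>e\<in>PiE (insert j S) F. ?f e) = (\<Sum>(s, e)\<in>F j \<times> PiE S F. ?f (e(j := s)))"
      unfolding PiE_insert_eq sum.reindex[OF inj_combinator[OF \<open>j \<notin> S\<close>]]
      by (simp only: comp_def case_prod_unfold)
    also have "\<dots> = (\<Sum>s\<in>F j. \<Sum>e\<in>PiE S F. ?f (e(j := s)))"
      by (rule sum.cartesian_product[symmetric])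
    also have "\<dots> = (\<Sum>e\<in>PiE S F. \<Sum>s\<in>F j. ?f (e(j := s)))"
      by (rule sum.swap)
    finally show ?thesis by (rule sym)
  qed
  finally show ?case using insert by simp
qed

text \<open>The estimate on spans involves finitely many basis tuples, whose sum is below the full
  Hilbert-Schmidt sum. Density of the spans then frees one coordinate at a time.\<close>

lemma nrm_le_hs_norm:
  fixes X :: "'i::finite \<Rightarrow> ('a, 'm) hspace_scheme"
  assumes hilbert: "\<And>i. hilbert_space K (X i)" and T: "multilinear_operator K X Y T"
    and E: "\<And>i. orthonormal_basis K (X i) (E i)" and hs: "hilbert_schmidt K X Y E T"
    and x: "x \<in> tuples X"
  shows "nrm Y (T x) \<le> hs_norm Y E T * (\<Prod>i\<in>UNIV. nrm (X i) (x i))"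
proof -
  interpret T: multilinear_operator K X Y T by (rule T)
  have bdd: "bdd_above (unit_ball_norms X Y T)"
    and summable: "(\<lambda>e. (nrm Y (T e))\<^sup>2) summable_on PiE UNIV E"
    using hs unfolding hilbert_schmidt_def bounded_multilinear_map_def by auto
  let ?hs = "hs_norm Y E T"
  have hs0: "?hs \<ge> 0" unfolding hs_norm_def by (auto intro: infsum_nonneg)
  have Esub: "E i \<subseteq> carrier (X i)"
    and orth: "e \<in> E i \<Longrightarrow> f \<in> E i \<Longrightarrow> ip (X i) e f = (if e = f then 1 else 0)"
    and dense: "mtopology_of (norm_metric (X i)) closure_of lin_span K (X i) (E i) = carrier (X i)"
    for i e f
    using E[of i] unfolding orthonormal_basis_def by auto
  have spans: "nrm Y (T y) \<le> ?hs * (\<Prod>i\<in>UNIV. nrm (X i) (y i))"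
    if y: "y \<in> tuples X" and span: "\<And>i. y i \<in> lin_span K (X i) (E i)" for y
  proof -
    \<comment> \<open>Bundles a finite expansion of the coordinate \<open>y i\<close>, so that
      finite sets and coefficients can be chosen for all \<open>i\<close> simultaneously.\<close>
    define P where "P i F c \<longleftrightarrow> finite F \<and> F \<subseteq> E i \<and> c \<in> F \<rightarrow> K \<and>
      y i = (\<Oplus>\<^bsub>X i\<^esub>s\<in>F. c s \<odot>\<^bsub>X i\<^esub> s)" for i F c
    have "\<exists>F c. P i F c" for i
      using span[of i] unfolding lin_span_def P_def by blast
    then obtain F c where Fc: "\<And>i. P i (F i) (c i)" by metis
    have F: "\<And>i. finite (F i)" "\<And>i. F i \<subseteq> E i" and c: "\<And>i. c i \<in> F i \<rightarrow> K"
      and yi: "\<And>i. y i = (\<Oplus>\<^bsub>X i\<^esub>s\<in>F i. c i s \<odot>\<^bsub>X i\<^esub> s)"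
      using Fc unfolding P_def by blast+
    have "(nrm Y (T y))\<^sup>2 \<le> (\<Prod>i\<in>UNIV. (nrm (X i) (y i))\<^sup>2) *
        (\<Sum>e\<in>PiE UNIV F. (nrm Y (T (override_on y e UNIV)))\<^sup>2)"
      using F Esub orth by (intro nrm_le_hs_on_spans[OF hilbert T F(1) _ _ c y yi]) blast+
    also have "\<dots> = (\<Prod>i\<in>UNIV. (nrm (X i) (y i))\<^sup>2) * (\<Sum>e\<in>PiE UNIV F. (nrm Y (T e))\<^sup>2)"
      by (simp add: override_on_def)
    also have "\<dots> \<le> (\<Prod>i\<in>UNIV. (nrm (X i) (y i))\<^sup>2) * (\<Sum>\<^sub>\<infinity>e\<in>PiE UNIV E. (nrm Y (T e))\<^sup>2)"
      by (intro mult_left_mono finite_sum_le_infsum summable finite_PiE PiE_mono prod_nonneg)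
        (use F in auto)
    also have "\<dots> = (?hs * (\<Prod>i\<in>UNIV. nrm (X i) (y i)))\<^sup>2"
      by (simp add: hs_norm_def power_mult_distrib infsum_nonneg prod_power_distrib)
    finally show ?thesis
    proof (rule power2_le_imp_le)
      show "0 \<le> ?hs * (\<Prod>i\<in>UNIV. nrm (X i) (y i))"
        using y by (intro mult_nonneg_nonneg hs0 prod_nonneg ballI T.X.nrm_nonneg) (auto simp: PiE_iff)
    qed
  qed
  \<comment> \<open>\<open>S\<close> is the set of coordinates allowed to be arbitrary, the others
    staying in the spans: the empty set is the case \<open>spans\<close>, and \<open>UNIV\<close> is
    the claim.\<close>
  have "\<forall>y\<in>tuples X. (\<forall>i. i \<notin> S \<longrightarrow> y i \<in> lin_span K (X i) (E i)) \<longrightarrow>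
      nrm Y (T y) \<le> ?hs * (\<Prod>i\<in>UNIV. nrm (X i) (y i))" for S
    using finite[of S]
  proof (induction S rule: finite_induct)
    case empty
    then show ?case using spans by simp
  next
    case (insert j S)
    show ?case
    proof (intro ballI impI)
      fix y assume y: "y \<in> tuples X" and ys: "\<forall>i. i \<notin> insert j S \<longrightarrow> y i \<in> lin_span K (X i) (E i)"
      have ynn: "nrm (X i) (y i) \<ge> 0" for i using y T.X.nrm_nonneg by (auto simp: PiE_iff)
      have yj: "y j \<in> carrier (X j)" using y by (auto simp: PiE_iff)
      define P where "P = (\<Prod>i\<in>UNIV - {j}. nrm (X i) (y i))"
      have P: "P \<ge> 0" unfolding P_def using ynn by (intro prod_nonneg) auto
      have upd: "(\<Prod>i\<in>UNIV. nrm (X i) ((y(j := v)) i)) = nrm (X j) v * P" for v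
        unfolding P_def by (subst prod.remove[of _ j]) (auto intro!: prod.cong)
      \<comment> \<open>Collects the two errors of replacing \<open>y j\<close> by a vector
        \<open>v\<close> of the span within distance \<open>r\<close>: the change in the value of
        \<open>T\<close>, and the possible growth of the norm of \<open>v\<close> over that of
        \<open>y j\<close>.\<close>
      define D where "D = mult_norm X Y T * P + ?hs * P"
      have D: "D \<ge> 0" unfolding D_def using T.mult_norm_nonneg[OF bdd] hs0 P by simp
      have step: "nrm Y (T y) \<le> ?hs * (nrm (X j) (y j) * P) + D * r" if "r > 0" for r
      proof -
        have "y j \<in> mtopology_of (norm_metric (X j)) closure_of lin_span K (X j) (E j)"
          using yj dense by simp
        then obtain v where v: "v \<in> lin_span K (X j) (E j)" "v \<in> carrier (X j)"
          and "norm_dist (X j) (y j) v < r"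
          using \<open>r > 0\<close> unfolding mtopology_of_def T.X.mspace_norm_metric T.X.mdist_norm_metric
            Metric_space.metric_closure_of[OF T.X.Metric_space_norm_dist]
            Metric_space.in_mball[OF T.X.Metric_space_norm_dist] by blast
        then have d: "nrm (X j) (y j \<ominus>\<^bsub>X j\<^esub> v) < r" by (simp add: norm_dist_def yj)
        have "v = (v \<ominus>\<^bsub>X j\<^esub> y j) \<oplus>\<^bsub>X j\<^esub> y j" using v yj by (simp add: T.X.minus_add_cancel)
        then have "nrm (X j) v \<le> nrm (X j) (v \<ominus>\<^bsub>X j\<^esub> y j) + nrm (X j) (y j)"
          using T.X.nrm_triangle[of "v \<ominus>\<^bsub>X j\<^esub> y j" j "y j"] v yj by simp
        then have nv: "nrm (X j) v \<le> nrm (X j) (y j) + r"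
          using d T.X.nrm_minus_commute[OF v(2) yj] by simp
        have "nrm Y (T (y(j := v))) \<le> ?hs * (nrm (X j) v * P)"
          unfolding upd[symmetric] using ys v T.upd_tuples[OF y v(2)]
          by (intro insert.IH[rule_format]) auto
        also have "\<dots> \<le> ?hs * ((nrm (X j) (y j) + r) * P)"
          by (intro mult_left_mono mult_right_mono nv P hs0)
        finally have 1: "nrm Y (T (y(j := v))) \<le> ?hs * ((nrm (X j) (y j) + r) * P)" .
        \<comment> \<open>The trivial update brings \<open>y\<close> into the form required by
          \<open>nrm_change_coordinate\<close>.\<close>
        have "nrm Y (T (y(j := y j)))
            \<le> nrm Y (T (y(j := v))) + mult_norm X Y T * P * nrm (X j) (y j \<ominus>\<^bsub>X j\<^esub> v)"
          unfolding P_def by (rule T.nrm_change_coordinate[OF bdd y yj v(2)])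
        also have "\<dots> \<le> ?hs * ((nrm (X j) (y j) + r) * P) + mult_norm X Y T * P * r"
          using d P T.mult_norm_nonneg[OF bdd] by (intro add_mono 1 mult_left_mono) auto
        finally show ?thesis by (simp add: D_def algebra_simps)
      qed
      have "nrm Y (T y) \<le> ?hs * (nrm (X j) (y j) * P)"
      proof (rule field_le_epsilon)
        fix e :: real assume "e > 0"
        \<comment> \<open>Dividing by \<open>D + 1\<close> keeps the radius well defined when
          \<open>D\<close> is zero.\<close>
        then have "D * (e / (D + 1)) \<le> e" using D by (simp add: field_simps)
        then show "nrm Y (T y) \<le> ?hs * (nrm (X j) (y j) * P) + e"
          using step[of "e / (D + 1)"] D \<open>e > 0\<close> by simp
      qed
      then show "nrm Y (T y) \<le> ?hs * (\<Prod>i\<in>UNIV. nrm (X i) (y i))"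
        using upd[of "y j"] by simp
    qed
  qed
  from this[of UNIV] show ?thesis using x by simp
qed

section \<open>Factorization through a space of functions on tuples\<close>

text \<open>The structure of \<open>H\<close> on \<open>S\<close>, carried over along \<phi> by
  computing with preimages. When \<phi> is injective on a subspace \<open>S\<close>, it becomes an
  isometric isomorphism onto this copy, which lives in the target type of \<phi>.\<close>

definition transport :: "('b \<Rightarrow> 'c) \<Rightarrow> 'b set \<Rightarrow> ('b, 'm) hspace_scheme \<Rightarrow> 'c hspace" where
  "transport \<phi> S H = (let \<psi> = inv_into S \<phi> in
     \<lparr>carrier = \<phi> ` S, mult = \<lambda>_ _. \<phi> \<zero>\<^bsub>H\<^esub>, one = \<phi> \<zero>\<^bsub>H\<^esub>, zero = \<phi> \<zero>\<^bsub>H\<^esub>,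
      add = \<lambda>f g. \<phi> (\<psi> f \<oplus>\<^bsub>H\<^esub> \<psi> g), smult = \<lambda>c f. \<phi> (c \<odot>\<^bsub>H\<^esub> \<psi> f),
      nrm = \<lambda>f. nrm H (\<psi> f), ip = \<lambda>f g. ip H (\<psi> f) (\<psi> g)\<rparr>)"

text \<open>Injectivity makes the preimages unambiguous, the closure properties keep the operations
  inside \<open>S\<close>, and topological closedness gives completeness of the copy.\<close>

locale embedded_subspace = hilbert_space K H
  for K :: "complex set" and H :: "('b, 'm) hspace_scheme" (structure) +
  fixes S :: "'b set" and \<phi> :: "'b \<Rightarrow> 'c"
  assumes zero_mem: "\<zero>\<^bsub>H\<^esub> \<in> S"
    and add_mem: "x \<in> S \<Longrightarrow> y \<in> S \<Longrightarrow> x \<oplus>\<^bsub>H\<^esub> y \<in> S"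
    and scale_mem: "c \<in> K \<Longrightarrow> x \<in> S \<Longrightarrow> c \<odot>\<^bsub>H\<^esub> x \<in> S"
    and closedin_S: "closedin (mtopology_of (norm_metric H)) S"
    and inj: "inj_on \<phi> S"
begin

abbreviation "G \<equiv> transport \<phi> S H"

lemma subset: "S \<subseteq> carrier H"
  using closedin_subset[OF closedin_S] by simp

lemma mem: "x \<in> S \<Longrightarrow> x \<in> carrier H"
  using subset by blast

lemma carrier_G: "carrier G = \<phi> ` S" and zero_G: "\<zero>\<^bsub>G\<^esub> = \<phi> \<zero>\<^bsub>H\<^esub>"
  by (simp_all add: transport_def Let_def)

lemma add_G: "x \<in> S \<Longrightarrow> y \<in> S \<Longrightarrow> \<phi> x \<oplus>\<^bsub>G\<^esub> \<phi> y = \<phi> (x \<oplus>\<^bsub>H\<^esub> y)"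
  and smult_G: "x \<in> S \<Longrightarrow> c \<odot>\<^bsub>G\<^esub> \<phi> x = \<phi> (c \<odot>\<^bsub>H\<^esub> x)"
  and nrm_G: "x \<in> S \<Longrightarrow> nrm G (\<phi> x) = nrm H x"
  and ip_G: "x \<in> S \<Longrightarrow> y \<in> S \<Longrightarrow> ip G (\<phi> x) (\<phi> y) = ip H x y"
  by (simp_all add: transport_def Let_def inv_into_f_f[OF inj])

lemmas G_simps = carrier_G zero_G add_G smult_G nrm_G ip_G add_mem scale_mem zero_mem mem

lemma normed_space_G: "normed_space K G"
proof -
  have grp: "abelian_group G"
  proof (rule abelian_groupI)
    fix f assume "f \<in> carrier G"
    then obtain x where x: "x \<in> S" "f = \<phi> x" by (auto simp: carrier_G)
    \<comment> \<open>Additive inverses are obtained as multiples by -1, since closure of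
      \<open>S\<close> is assumed for sums and scalar multiples.\<close>
    have "(- 1) \<odot>\<^bsub>H\<^esub> x \<in> S" using x uminus_one_scalar by (simp add: scale_mem)
    then show "\<exists>g\<in>carrier G. g \<oplus>\<^bsub>G\<^esub> f = \<zero>\<^bsub>G\<^esub>"
      using x by (intro bexI[of _ "\<phi> ((- 1) \<odot>\<^bsub>H\<^esub> x)"]) (auto simp: G_simps add_smult_uminus)
  next
    fix f g assume "f \<in> carrier G" "g \<in> carrier G"
    then show "f \<oplus>\<^bsub>G\<^esub> g = g \<oplus>\<^bsub>G\<^esub> f" by (auto simp: G_simps M.a_comm)
  qed (auto simp: G_simps M.a_assoc)
  have "Module.module (scalar_ring K) G"
  proof (rule Module.moduleI[OF R.is_cring grp])
    show "a \<odot>\<^bsub>G\<^esub> f \<in> carrier G" if "a \<in> carrier (scalar_ring K)" "f \<in> carrier G" for a f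
      using that by (auto simp: G_simps scalar_ring_def)
    show "(a \<oplus>\<^bsub>scalar_ring K\<^esub> b) \<odot>\<^bsub>G\<^esub> f = a \<odot>\<^bsub>G\<^esub> f \<oplus>\<^bsub>G\<^esub> b \<odot>\<^bsub>G\<^esub> f"
      if "a \<in> carrier (scalar_ring K)" "b \<in> carrier (scalar_ring K)" "f \<in> carrier G" for a b f
    proof -
      obtain x where "x \<in> S" "f = \<phi> x" using \<open>f \<in> carrier G\<close> by (auto simp: carrier_G)
      moreover have "a \<in> K" "b \<in> K" using that by (auto simp: scalar_ring_def)
      ultimately show ?thesis using smult_l_distr[OF that(1,2)] by (simp add: G_simps)
    qed
    show "a \<odot>\<^bsub>G\<^esub> (f \<oplus>\<^bsub>G\<^esub> g) = a \<odot>\<^bsub>G\<^esub> f \<oplus>\<^bsub>G\<^esub> a \<odot>\<^bsub>G\<^esub> g"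
      if "a \<in> carrier (scalar_ring K)" "f \<in> carrier G" "g \<in> carrier G" for a f g
    proof -
      obtain x y where "x \<in> S" "f = \<phi> x" "y \<in> S" "g = \<phi> y"
        using \<open>f \<in> carrier G\<close> \<open>g \<in> carrier G\<close> unfolding carrier_G by blast
      moreover have "a \<in> K" using that by (auto simp: scalar_ring_def)
      ultimately show ?thesis using smult_r_distr[OF that(1)] by (simp add: G_simps)
    qed
    show "(a \<otimes>\<^bsub>scalar_ring K\<^esub> b) \<odot>\<^bsub>G\<^esub> f = a \<odot>\<^bsub>G\<^esub> (b \<odot>\<^bsub>G\<^esub> f)"
      if "a \<in> carrier (scalar_ring K)" "b \<in> carrier (scalar_ring K)" "f \<in> carrier G" for a b f
    proof -
      obtain x where "x \<in> S" "f = \<phi> x" using \<open>f \<in> carrier G\<close> by (auto simp: carrier_G)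
      moreover have "a \<in> K" "b \<in> K" using that by (auto simp: scalar_ring_def)
      ultimately show ?thesis using smult_assoc1[OF that(1,2)] by (simp add: G_simps)
    qed
    show "\<one>\<^bsub>scalar_ring K\<^esub> \<odot>\<^bsub>G\<^esub> f = f" if "f \<in> carrier G" for f
      using that by (auto simp: G_simps)
  qed
  moreover have "normed_space_axioms K G"
  proof
    show "K = \<real> \<or> K = UNIV" by (rule scalars)
    show "f = \<zero>\<^bsub>G\<^esub>" if "f \<in> carrier G" and f: "nrm G f = 0" for f
    proof -
      obtain x where x: "x \<in> S" "f = \<phi> x" using \<open>f \<in> carrier G\<close> by (auto simp: carrier_G)
      then have "x = \<zero>\<^bsub>H\<^esub>" using f nrm_eq_zero[of x] by (simp add: G_simps)
      then show ?thesis using x by (simp add: zero_G)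
    qed
  qed (auto simp: G_simps nrm_nonneg nrm_smult nrm_triangle)
  ultimately show ?thesis by (rule normed_space.intro)
qed

lemma norm_dist_G:
  assumes "x \<in> S" "y \<in> S"
  shows "norm_dist G (\<phi> x) (\<phi> y) = norm_dist H x y"
proof -
  interpret G: normed_space K G by (rule normed_space_G)
  have "(- 1) \<odot>\<^bsub>H\<^esub> y \<in> S" using assms uminus_one_scalar by (simp add: scale_mem)
  moreover have "\<phi> x \<in> carrier G" "\<phi> y \<in> carrier G" using assms by (auto simp: carrier_G)
  ultimately show ?thesis
    using assms by (simp add: norm_dist_def a_minus_def G.a_inv_eq_smult a_inv_eq_smult G_simps)
qed

text \<open>For completeness, a Cauchy sequence is pulled back isometrically to \<open>S\<close>,
  converges in \<open>H\<close>, and has its limit in \<open>S\<close> by closedness; the image of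
  the limit is the limit in the copy.\<close>

lemma hilbert_space_G: "hilbert_space K G"
proof -
  interpret G: normed_space K G by (rule normed_space_G)
  interpret H: Metric_space "carrier H" "norm_dist H" by (rule Metric_space_norm_dist)
  interpret GM: Metric_space "carrier G" "norm_dist G" by (rule G.Metric_space_norm_dist)
  have "GM.mcomplete"
    unfolding GM.mcomplete_def
  proof (intro allI impI)
    fix \<sigma> assume \<sigma>: "GM.MCauchy \<sigma>"
    then have "range \<sigma> \<subseteq> \<phi> ` S"
      unfolding GM.MCauchy_def by (simp only: carrier_G)
    then have "\<exists>s. s \<in> S \<and> \<sigma> n = \<phi> s" for n by blast
    then obtain \<tau> where \<tau>: "\<And>n. \<tau> n \<in> S" and \<sigma>\<tau>: "\<And>n. \<sigma> n = \<phi> (\<tau> n)" by metis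
    have "H.MCauchy \<tau>"
      using \<sigma> \<tau> mem unfolding GM.MCauchy_def H.MCauchy_def by (auto simp: \<sigma>\<tau> norm_dist_G)
    moreover have "H.mcomplete" using complete by (simp add: mcomplete_of_def)
    ultimately obtain l where l: "limitin H.mtopology \<tau> l sequentially"
      unfolding H.mcomplete_def by blast
    have "closedin H.mtopology S" using closedin_S by (simp add: mtopology_of_def)
    moreover have "range \<tau> \<subseteq> S" using \<tau> by blast
    ultimately have "l \<in> S"
      unfolding H.metric_closedin_iff_sequentially_closed using l by meson
    have "limitin GM.mtopology \<sigma> (\<phi> l) sequentially"
      using l \<open>l \<in> S\<close> \<tau>
      unfolding H.limit_metric_sequentially GM.limit_metric_sequentially
      by (simp add: \<sigma>\<tau> norm_dist_G carrier_G mem)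
    then show "\<exists>f. limitin GM.mtopology \<sigma> f sequentially" by blast
  qed
  then have "banach_space K G"
    by (intro banach_space.intro banach_space_axioms.intro normed_space_G)
      (simp add: mcomplete_of_def)
  moreover have "hilbert_space_axioms K G"
  proof
    show "ip G g f = cnj (ip G f g)" if "f \<in> carrier G" "g \<in> carrier G" for f g
    proof -
      obtain x y where xy: "x \<in> S" "f = \<phi> x" "y \<in> S" "g = \<phi> y"
        using \<open>f \<in> carrier G\<close> \<open>g \<in> carrier G\<close> unfolding carrier_G by blast
      show ?thesis unfolding xy(2,4) ip_G[OF xy(1,3)] ip_G[OF xy(3,1)]
        by (rule ip_cnj[OF mem[OF xy(1)] mem[OF xy(3)]])
    qed
  qed (auto simp: G_simps ip_scalar ip_add ip_smult ip_self)
  ultimately show ?thesis by (rule hilbert_space.intro)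
qed

end

section \<open>Lipschitz constants and bounds for the factorization norm\<close>

lemma lip_const_nonneg:
  assumes "Lipschitz_continuous_map (submetric (norm_metric G) M) (norm_metric Y) B"
    and "normed_space K G" "M \<subseteq> carrier G"
  shows "0 \<le> lip_const G M Y B"
proof -
  interpret G: normed_space K G by fact
  obtain L where "\<forall>u\<in>M. \<forall>v\<in>M.
      mdist (norm_metric Y) (B u) (B v) \<le> L * mdist (norm_metric G) u v"
    using assms(1,3) unfolding Lipschitz_continuous_map_def
    by (auto simp: Int_absorb2)
  then have L: "mdist (norm_metric Y) (B u) (B v) \<le> L * mdist (norm_metric G) u v"
    if "u \<in> M" "v \<in> M" for u v
    using that by blast
  \<comment> \<open>Lipschitz continuity supplies a constant of unspecified sign, while
    \<open>lip_const\<close> ranges over nonnegative ones. Passing to the maximum with 0 shows that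
    its defining set is nonempty.\<close>
  have "mdist (norm_metric Y) (B u) (B v) \<le> max L 0 * mdist (norm_metric G) u v"
    if "u \<in> M" "v \<in> M" for u v
  proof -
    have "L * mdist (norm_metric G) u v \<le> max L 0 * mdist (norm_metric G) u v"
      by (intro mult_right_mono)
        (simp_all add: Metric_space.nonneg[OF G.Metric_space_norm_dist])
    then show ?thesis using L[OF that] by linarith
  qed
  then have "max L 0 \<in> {L. 0 \<le> L \<and> (\<forall>u\<in>M. \<forall>v\<in>M.
      mdist (norm_metric Y) (B u) (B v) \<le> L * mdist (norm_metric G) u v)}"
    by simp
  then show ?thesis unfolding lip_const_def by (intro cInf_greatest) blast+
qed

lemma lip_const_le:
  assumes "0 \<le> L" and "\<And>u v. u \<in> M \<Longrightarrow> v \<in> M \<Longrightarrow>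
    mdist (norm_metric Y) (B u) (B v) \<le> L * mdist (norm_metric G) u v"
  shows "lip_const G M Y B \<le> L"
  unfolding lip_const_def by (rule cInf_lower) (use assms in \<open>auto intro: bdd_belowI[of _ 0]\<close>)

text \<open>Supplies the lower bound 0 for the set whose infimum is \<open>gamma_norm\<close>, so
  that every factorization bounds that infimum from above.\<close>

lemma hilbert_factorization_nonneg:
  assumes "hilbert_factorization K X Y T G M A B" "\<And>i. normed_space K (X i)"
  shows "0 \<le> mult_norm X G A * lip_const G M Y B"
proof -
  have G: "normed_space K G"
    using assms(1) unfolding hilbert_factorization_def
    by (auto dest: hilbert_space.axioms(1) banach_space.axioms(1))
  interpret A: multilinear_operator K X G A
    using assms G unfolding hilbert_factorization_def bounded_multilinear_map_def
    by (intro multilinear_operator.intro) auto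
  have "0 \<le> mult_norm X G A"
    using assms unfolding hilbert_factorization_def bounded_multilinear_map_def
    by (intro A.mult_norm_nonneg) auto
  moreover have "0 \<le> lip_const G M Y B"
    using assms G unfolding hilbert_factorization_def by (intro lip_const_nonneg) auto
  ultimately show ?thesis by simp
qed

lemma gamma_norm_le:
  fixes X :: "'i::finite \<Rightarrow> ('a, 'm) nspace_scheme" and G :: "(('i \<Rightarrow> 'a) \<Rightarrow> complex) hspace"
  assumes "hilbert_factorization K X Y T G M A B" "\<And>i. normed_space K (X i)"
  shows "gamma_norm K X Y T \<le> mult_norm X G A * lip_const G M Y B"
  unfolding gamma_norm_def
proof (rule cInf_lower)
  show "bdd_below {mult_norm X G A * lip_const G M Y B |
      (G :: (('i \<Rightarrow> 'a) \<Rightarrow> complex) hspace) M A B. hilbert_factorization K X Y T G M A B}"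
    by (rule bdd_belowI[of _ 0]) (use hilbert_factorization_nonneg assms(2) in blast)
qed (use assms(1) in blast)

text \<open>The space is a copy of the double annihilator of the range of \<open>T\<close>; the
  first map is \<open>T\<close> followed by the embedding \<phi>, the second is the inverse of
  \<phi>. As \<phi> is isometric for the transported norm, the operator norm is unchanged and the
  second map has Lipschitz constant at most 1.\<close>

lemma hilbert_factorization_self:
  fixes X :: "'i::finite \<Rightarrow> ('a, 'm) nspace_scheme" and H :: "('b, 'l) hspace_scheme"
  assumes H: "hilbert_space K H" and X: "\<And>i. normed_space K (X i)"
    and T: "bounded_multilinear_map K X H T"
  shows "\<exists>(G :: (('i \<Rightarrow> 'a) \<Rightarrow> complex) hspace) M A B. hilbert_factorization K X H T G M A B \<and>
    mult_norm X G A = mult_norm X H T \<and> lip_const G M H B \<le> 1"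
proof -
  interpret hilbert_space K H by (rule H)
  interpret T: multilinear_operator K X H T
    using X T normed_space_axioms unfolding bounded_multilinear_map_def
    by (intro multilinear_operator.intro) auto
  define R where "R = T ` tuples X"
  \<comment> \<open>As an annihilator this is a closed subspace, and it contains \<open>R\<close> by
    conjugate symmetry of the inner product.\<close>
  define S where "S = annihilator H (annihilator H R)"
  define \<phi> where "\<phi> g = (\<lambda>x. if x \<in> tuples X then ip H g (T x) else 0)" for g
  have Rsub: "R \<subseteq> carrier H" unfolding R_def using T.closed by blast
  have sub: "annihilator H A \<subseteq> carrier H" for A by (auto simp: annihilator_def)
  have TS: "T x \<in> S" if "x \<in> tuples X" for x
  proof -
    have "ip H (T x) g = 0" if g: "g \<in> annihilator H R" for g
      using ip_cnj[of g "T x"] g \<open>x \<in> tuples X\<close> T.closed[of x] by (auto simp: annihilator_def R_def)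
    then show ?thesis using T.closed[OF that] by (simp add: S_def annihilator_def)
  qed
  note subspace = annihilator_subspace[OF sub[of R], folded S_def]
  have inj: "inj_on \<phi> S"
  proof (rule inj_onI)
    fix g h assume g: "g \<in> S" and h: "h \<in> S" and eq: "\<phi> g = \<phi> h"
    have gh: "g \<in> carrier H" "h \<in> carrier H" using g h sub unfolding S_def by blast+
    \<comment> \<open>Equal images under \<phi> mean that \<open>g - h\<close> is orthogonal to
      \<open>R\<close>. It also lies in the double annihilator, so it is orthogonal to
      itself.\<close>
    have "ip H (g \<ominus>\<^bsub>H\<^esub> h) (T x) = 0" if "x \<in> tuples X" for x
      using fun_cong[OF eq, of x] that gh T.closed[OF that] by (simp add: \<phi>_def ip_minus)
    then have "g \<ominus>\<^bsub>H\<^esub> h \<in> annihilator H R" using gh by (auto simp: annihilator_def R_def)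
    moreover have "g \<ominus>\<^bsub>H\<^esub> h \<in> S"
      unfolding a_minus_def using subspace g h gh uminus_one_scalar by (simp add: a_inv_eq_smult)
    ultimately have "g \<ominus>\<^bsub>H\<^esub> h = \<zero>\<^bsub>H\<^esub>"
      unfolding S_def by (intro annihilator_self_zero)
    then show "g = h" using minus_add_cancel[OF gh] gh by simp
  qed
  interpret S: embedded_subspace K H S \<phi>
    by unfold_locales
      (use subspace inj closedin_annihilator[OF sub[of R], folded S_def] in auto)
  let ?G = "transport \<phi> S H" let ?A = "\<lambda>x. \<phi> (T x)" let ?B = "inv_into S \<phi>"
  interpret G: hilbert_space K ?G by (rule S.hilbert_space_G)
  have B: "?B (\<phi> s) = s" if "s \<in> S" for s using inj that by (rule inv_into_f_f)
  \<comment> \<open>The two sets coincide because \<phi> preserves norms on \<open>S\<close>, where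
    all values of \<open>T\<close> lie. Boundedness and the operator norm carry over at
    once.\<close>
  have norms: "unit_ball_norms X ?G ?A = unit_ball_norms X H T"
    unfolding unit_ball_norms_def using TS by (metis (lifting) S.nrm_G)
  have dist: "norm_dist H (?B u) (?B v) = norm_dist ?G u v" if "u \<in> carrier ?G" "v \<in> carrier ?G" for u v
    using that by (auto simp: S.carrier_G B S.norm_dist_G)
  have "multilinear_map K X ?G ?A"
    unfolding multilinear_map_def
  proof (intro conjI ballI allI)
    fix x assume x: "x \<in> tuples X"
    show "\<phi> (T x) \<in> carrier ?G" using TS[OF x] by (simp add: S.carrier_G)
    fix i u assume u: "u \<in> carrier (X i)"
    show "\<phi> (T (x(i := c \<odot>\<^bsub>X i\<^esub> u))) = c \<odot>\<^bsub>?G\<^esub> \<phi> (T (x(i := u)))" if "c \<in> K" for c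
      using T.smult[OF x that u] TS[OF T.upd_tuples[OF x u]] by (simp only: S.smult_G)
    show "\<phi> (T (x(i := u \<oplus>\<^bsub>X i\<^esub> v))) = \<phi> (T (x(i := u))) \<oplus>\<^bsub>?G\<^esub> \<phi> (T (x(i := v)))"
      if v: "v \<in> carrier (X i)" for v
      using T.add[OF x u v] TS[OF T.upd_tuples[OF x u]] TS[OF T.upd_tuples[OF x v]]
      by (simp only: S.add_G)
  qed
  then have A: "bounded_multilinear_map K X ?G ?A"
    using T norms by (simp add: bounded_multilinear_map_def)
  have "Lipschitz_continuous_map (submetric (norm_metric ?G) (carrier ?G)) (norm_metric H) ?B"
    unfolding Lipschitz_continuous_map_def
  proof (intro conjI exI[of _ 1] ballI)
    show "?B \<in> mspace (submetric (norm_metric ?G) (carrier ?G)) \<rightarrow> mspace (norm_metric H)"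
      by (auto simp: S.carrier_G B S.mem)
  qed (auto simp: dist)
  \<comment> \<open>The subset \<open>M\<close> is taken to be the whole carrier, on which the
    inverse of \<phi> is defined and isometric.\<close>
  then have "hilbert_factorization K X H T ?G (carrier ?G) ?A ?B"
    unfolding hilbert_factorization_def
    using A S.hilbert_space_G TS B by (auto simp: S.carrier_G)
  moreover have "mult_norm X ?G ?A = mult_norm X H T" by (simp add: mult_norm_def norms)
  \<comment> \<open>Only an inequality in general: for \<open>T\<close> identically zero the copy is
    a single point and the least constant is 0.\<close>
  moreover have "lip_const ?G (carrier ?G) H ?B \<le> 1" by (rule lip_const_le) (auto simp: dist)
  ultimately show ?thesis by blast
qed

theorem proposition2p2:
  fixes K :: "complex set"
    and Hs :: "'i::finite \<Rightarrow> 'a hspace"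
    and H :: "'b hspace"
    and E :: "'i \<Rightarrow> 'a set"
    and T :: "('i \<Rightarrow> 'a) \<Rightarrow> 'b"
  assumes "\<And>i. hilbert_space K (Hs i)"
    and "hilbert_space K H"
    and "\<And>i. orthonormal_basis K (Hs i) (E i)"
    and "hilbert_schmidt K Hs H E T"
  shows "factors_through_hilbert K Hs H T \<and> gamma_norm K Hs H T \<le> hs_norm H E T"
proof -
  have Hs: "normed_space K (Hs i)" for i
    using assms(1) hilbert_space.axioms(1) banach_space.axioms(1) by blast
  have H: "normed_space K H"
    using assms(2) hilbert_space.axioms(1) banach_space.axioms(1) by blast
  have bounded: "bounded_multilinear_map K Hs H T" and multilinear: "multilinear_map K Hs H T"
    using assms(4) unfolding hilbert_schmidt_def bounded_multilinear_map_def by auto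
  interpret T: multilinear_operator K Hs H T
    using Hs H multilinear by (rule multilinear_operator.intro)
  obtain G :: "(('i \<Rightarrow> 'a) \<Rightarrow> complex) hspace" and M A B
    where fact: "hilbert_factorization K Hs H T G M A B"
      and A: "mult_norm Hs G A = mult_norm Hs H T" and B: "lip_const G M H B \<le> 1"
    using hilbert_factorization_self[OF assms(2) Hs bounded] by blast
  have hs0: "0 \<le> hs_norm H E T" unfolding hs_norm_def by (auto intro: infsum_nonneg)
  \<comment> \<open>On the unit ball the product of the coordinate norms is at most 1, so the
    pointwise bound by the Hilbert-Schmidt norm passes to the supremum.\<close>
  have "mult_norm Hs H T \<le> hs_norm H E T"
    unfolding mult_norm_def
  proof (rule cSup_least[OF T.unit_ball_norms_nonempty])
    fix t assume "t \<in> unit_ball_norms Hs H T"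
    then obtain x where x: "x \<in> tuples Hs" "\<And>i. nrm (Hs i) (x i) \<le> 1" and t: "t = nrm H (T x)"
      unfolding unit_ball_norms_def by blast
    have "(\<Prod>i\<in>UNIV. nrm (Hs i) (x i)) \<le> 1"
      using x by (intro prod_le_1) (auto simp: PiE_iff T.X.nrm_nonneg)
    then have "hs_norm H E T * (\<Prod>i\<in>UNIV. nrm (Hs i) (x i)) \<le> hs_norm H E T"
      using mult_left_mono[OF _ hs0] by fastforce
    then show "t \<le> hs_norm H E T"
      using nrm_le_hs_norm[OF assms(1) T.multilinear_operator_axioms assms(3,4) x(1)] t by simp
  qed
  moreover have "gamma_norm K Hs H T \<le> mult_norm Hs H T * lip_const G M H B"
    using gamma_norm_le[OF fact Hs] A by simp
  moreover have "mult_norm Hs H T * lip_const G M H B \<le> mult_norm Hs H T"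
    using mult_left_mono[OF B T.mult_norm_nonneg] bounded
    by (simp add: bounded_multilinear_map_def)
  ultimately show ?thesis
    using fact multilinear unfolding factors_through_hilbert_def by fastforce
qed

end
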